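(* Let $S,\Sigma\subset\Omega$ be measurable with $0<\mu(S),\mu(\Sigma)<\infty$, let $\varepsilon_0\in(0,1)$ and let $\varepsilon,\varepsilon_1,\varepsilon_2\in(0,1)$. (1) If $f\in L^2(\varepsilon_1,\varepsilon_2,S,\Sigma)$, then $$\left\|f-\sum_{n=1}^{n(\varepsilon_0,S,\Sigma)}\langle f,\varphi_n\rangle_\mu\varphi_n\right\|_{2,\mu}\le\sqrt{\frac{2\varepsilon_1+\varepsilon_2}{\varepsilon_0}}\;\|f\|_{2,\mu}.$$ (2) If $f\in L^2(\Omega,\mu)$ is $\varepsilon$-localized with respect to $L_{S,\Sigma}$, then $$\left\|f-\sum_{n=1}^{n(\varepsilon_0,S,\Sigma)}\langle f,\varphi_n\rangle_\mu\varphi_n\right\|_{2,\mu}\le\sqrt{\frac{2\varepsilon}{\varepsilon_0}}\;\|f\|_{2,\mu}.$$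
   Context: Setting: $\Omega\subset\mathbb{R}^d$ is a convex cone ($\lambda x\in\Omega$ for all $\lambda>0$, $x\in\Omega$) with non-empty interior, endowed with a Borel measure $\mu$, absolutely continuous with respect to Lebesgue measure, with polar decomposition $d\mu(r\zeta)=r^{2a-1}\,dr\,Q(\zeta)\,d\omega(\zeta)$, where $a>0$, $d\omega$ is the surface measure on the unit sphere $\mathbb{S}^{d-1}$, and $Q\in L^1(\mathbb{S}^{d-1},d\omega)$, $Q\ne 0$ (so $\mu$ is homogeneous of degree $2a$). $\|\cdot\|_{p,\mu}$ is the norm of $L^p(\Omega,\mu)$ and $\langle f,g\rangle_\mu=\int_\Omega f\overline{g}\,d\mu$. The kernel $\mathcal{K}:\Omega\times\Omega\to\mathbb{C}$ is continuous, bounded ($|\mathcal{K}(x,\xi)|\le c_{\mathcal{K}}$) and homogeneous ($\mathcal{K}(\lambda x,\xi)=\mathcal{K}(x,\lambda\xi)$ for $\lambda>0$). The operator $\mathcal{T}$ is $\mathcal{T}f(\xi)=\int_\Omega f(x)\mathcal{K}(x,\xi)\,d\mu(x)$. It is assumed that (i) (inversion) if $f,\mathcal{T}f\in L^1(\Omega,\mu)$ then $f$ is continuous and $f(x)=\int_\Omega\mathcal{T}f(\xi)\overline{\mathcal{K}(x,\xi)}\,d\mu(\xi)$ for almost every $x$; (ii) (Parseval) $\langle\mathcal{T}f,\mathcal{T}g\rangle_\mu=\langle f,g\rangle_\mu$ for Schwartz functions $f,g$ on $\Omega$; in particular $\mathcal{T}$ extends to a unitary operator of $L^2(\Omega,\mu)$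 onto itself, with $\mathcal{T}^{-1}f=\overline{\mathcal{T}\overline{f}}$. For measurable $A\subset\Omega$, $A^c=\Omega\setminus A$, $E_Af=\chi_Af$ and $F_Af=\mathcal{T}^{-1}[\chi_A\mathcal{T}f]$ on $L^2(\Omega,\mu)$. $L_{S,\Sigma}=E_SF_\Sigma E_S$ is a compact (trace class), positive, self-adjoint operator on $L^2(\Omega,\mu)$; write $L_{S,\Sigma}f=\sum_{n=1}^\infty\lambda_n\langle f,\varphi_n\rangle_\mu\varphi_n$, where $\lambda_1\ge\lambda_2\ge\cdots$ are its positive eigenvalues counted with multiplicity and $\{\varphi_n\}$ is a corresponding orthonormal set of eigenfunctions. $n(\varepsilon_0,S,\Sigma)=\operatorname{card}\{n:\lambda_n\ge1-\varepsilon_0\}$. $L^2(\varepsilon_1,\varepsilon_2,S,\Sigma)$ is the set of nonzero $f\in L^2(\Omega,\mu)$ with $\|E_{S^c}f\|_{2,\mu}\le\varepsilon_1\|f\|_{2,\mu}$ and $\|F_{\Sigma^c}f\|_{2,\mu}\le\varepsilon_2\|f\|_{2,\mu}$. A nonzero $f\in L^2(\Omega,\mu)$ is $\varepsilon$-localized with respect to $L$ if $\|Lf-f\|_{2,\mu}\le\varepsilon\|f\|_{2,\mu}$. *)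

theory Defs
  imports "HOL-Analysis.Analysis"
begin

text \<open>
  Elements of the Lebesgue spaces are represented by complex functions on the whole type; equality
  of such elements is equality almost everywhere with respect to \<open>M\<close>. Membership in the space of
  integrable functions is \<^const>\<open>integrable\<close>.
\<close>

definition L2 :: "'a measure \<Rightarrow> ('a \<Rightarrow> complex) set" where
  "L2 M = {f \<in> borel_measurable M. integrable M (\<lambda>x. (cmod (f x))\<^sup>2)}"

definition L2_norm :: "'a measure \<Rightarrow> ('a \<Rightarrow> complex) \<Rightarrow> real" where
  "L2_norm M f = sqrt (\<integral>x. (cmod (f x))\<^sup>2 \<partial>M)"

definition L2_inner :: "'a measure \<Rightarrow> ('a \<Rightarrow> complex) \<Rightarrow> ('a \<Rightarrow> complex) \<Rightarrow> complex" where
  "L2_inner M f g = (\<integral>x. f x * cnj (g x) \<partial>M)"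

definition unitary_on_L2 ::
    "'a measure \<Rightarrow> (('a \<Rightarrow> complex) \<Rightarrow> 'a \<Rightarrow> complex) \<Rightarrow> bool" where
  "unitary_on_L2 M U \<longleftrightarrow>
     (\<forall>f\<in>L2 M. U f \<in> L2 M) \<and>
     (\<forall>f\<in>L2 M. \<forall>g\<in>L2 M. AE x in M. U (\<lambda>y. f y + g y) x = U f x + U g x) \<and>
     (\<forall>c. \<forall>f\<in>L2 M. AE x in M. U (\<lambda>y. c * f y) x = c * U f x) \<and>
     (\<forall>f\<in>L2 M. \<forall>g\<in>L2 M. L2_inner M (U f) (U g) = L2_inner M f g) \<and>
     (\<forall>g\<in>L2 M. \<exists>f\<in>L2 M. AE x in M. U f x = g x)"

definition L2_inverse ::
    "'a measure \<Rightarrow> (('a \<Rightarrow> complex) \<Rightarrow> 'a \<Rightarrow> complex) \<Rightarrow> ('a \<Rightarrow> complex) \<Rightarrow> 'a \<Rightarrow> complex" where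
  "L2_inverse M U g = (SOME f. f \<in> L2 M \<and> (AE x in M. U f x = g x))"


text \<open>
  Surface measure on the unit sphere: the measure of a Borel set \<open>A\<close> of unit vectors is \<open>d\<close> times
  the volume of the truncated cone of all \<open>r\<zeta>\<close> with \<open>\<zeta>\<close> in \<open>A\<close> and \<open>0 < r \<le> 1\<close>.
\<close>

definition sphere_measure :: "'a::euclidean_space measure" where
  "sphere_measure =
     scale_measure (of_nat DIM('a))
       (distr (restrict_space lborel (cball 0 1 - {0})) (restrict_space borel (sphere 0 1)) sgn)"

primrec iterated_partial ::
    "'a list \<Rightarrow> ('a::euclidean_space \<Rightarrow> complex) \<Rightarrow> 'a \<Rightarrow> complex" where
  "iterated_partial [] f = f"
| "iterated_partial (b # bs) f = (\<lambda>x. frechet_derivative (iterated_partial bs f) (at x) b)"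

text \<open>A Schwartz function on a subset \<open>\<Omega>\<close> is the restriction to \<open>\<Omega>\<close> of one of the following.\<close>

definition schwartz :: "('a::euclidean_space \<Rightarrow> complex) \<Rightarrow> bool" where
  "schwartz f \<longleftrightarrow>
     (\<forall>bs\<in>lists Basis.
        (\<forall>x. iterated_partial bs f differentiable (at x)) \<and>
        (\<forall>k::nat. bounded (range (\<lambda>x. norm x ^ k *\<^sub>R iterated_partial bs f x))))"


definition integral_op ::
    "'a measure \<Rightarrow> ('a \<Rightarrow> 'a \<Rightarrow> complex) \<Rightarrow> ('a \<Rightarrow> complex) \<Rightarrow> 'a \<Rightarrow> complex" where
  "integral_op M K f \<xi> = (\<integral>x. f x * K x \<xi> \<partial>M)"

text \<open>
  The measure \<open>\<mu>\<close> lives on the Borel subsets of the subspace \<open>\<Omega>\<close>. Since \<open>\<Omega>\<close> itself need not be a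
  Borel set, the outer integral of the polar decomposition uses the completed surface measure.
  \<open>U\<close> is the extension of the integral operator to a unitary operator. That it exists and that its
  inverse has the stated form does not follow from the inversion and Parseval formulas
  (for instance, a kernel that is not symmetric may violate the formula for the inverse), so these
  are assumptions as well.
\<close>

locale integral_transform =
  fixes \<Omega> :: "'a::euclidean_space set"
    and \<mu> :: "'a measure"
    and a :: real
    and Q :: "'a \<Rightarrow> real"
    and K :: "'a \<Rightarrow> 'a \<Rightarrow> complex"
    and c\<^sub>K :: real
    and U :: "('a \<Rightarrow> complex) \<Rightarrow> 'a \<Rightarrow> complex"
  assumes convex_domain: "convex \<Omega>"
    and cone_domain: "\<And>x r. x \<in> \<Omega> \<Longrightarrow> r > 0 \<Longrightarrow> r *\<^sub>R x \<in> \<Omega>"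
    and interior_domain: "interior \<Omega> \<noteq> {}"
    and sets_measure: "sets \<mu> = sets (restrict_space borel \<Omega>)"
    and absolutely_continuous_measure:
      "\<And>B. B \<in> sets \<mu> \<Longrightarrow> B \<in> null_sets lebesgue \<Longrightarrow> emeasure \<mu> B = 0"
    and a_pos: "a > 0"
    and integrable_Q: "integrable sphere_measure Q"
    and nonneg_Q: "AE \<zeta> in sphere_measure. \<zeta> \<in> \<Omega> \<longrightarrow> Q \<zeta> \<ge> 0"
    and nonzero_Q: "\<not> (AE \<zeta> in sphere_measure. Q \<zeta> = 0)"
    and polar_decomposition:
      "\<And>B. B \<in> sets \<mu> \<Longrightarrow>
         emeasure \<mu> B =
           (\<integral>\<^sup>+\<zeta>. (\<integral>\<^sup>+r\<in>{0<..}. ennreal (r powr (2 * a - 1) * Q \<zeta>) * indicator B (r *\<^sub>R \<zeta>) \<partial>lborel)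
              \<partial>completion sphere_measure)"
    and continuous_kernel: "continuous_on (\<Omega> \<times> \<Omega>) (\<lambda>(x, \<xi>). K x \<xi>)"
    and bounded_kernel: "\<And>x \<xi>. x \<in> \<Omega> \<Longrightarrow> \<xi> \<in> \<Omega> \<Longrightarrow> cmod (K x \<xi>) \<le> c\<^sub>K"
    and homogeneous_kernel:
      "\<And>x \<xi> r. x \<in> \<Omega> \<Longrightarrow> \<xi> \<in> \<Omega> \<Longrightarrow> r > 0 \<Longrightarrow> K (r *\<^sub>R x) \<xi> = K x (r *\<^sub>R \<xi>)"
    and inversion:
      "\<And>f. integrable \<mu> f \<Longrightarrow> integrable \<mu> (integral_op \<mu> K f) \<Longrightarrow>
         (\<exists>g. continuous_on \<Omega> g \<and> (AE x in \<mu>. f x = g x)) \<and>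
         (AE x in \<mu>. f x = (\<integral>\<xi>. integral_op \<mu> K f \<xi> * cnj (K x \<xi>) \<partial>\<mu>))"
    and parseval:
      "\<And>f g. schwartz f \<Longrightarrow> schwartz g \<Longrightarrow>
         L2_inner \<mu> (integral_op \<mu> K f) (integral_op \<mu> K g) = L2_inner \<mu> f g"
    and extension:
      "\<And>f. integrable \<mu> f \<Longrightarrow> f \<in> L2 \<mu> \<Longrightarrow> AE \<xi> in \<mu>. U f \<xi> = integral_op \<mu> K f \<xi>"
    and unitary: "unitary_on_L2 \<mu> U"
    and inverse:
      "\<And>f. f \<in> L2 \<mu> \<Longrightarrow> AE x in \<mu>. L2_inverse \<mu> U f x = cnj (U (\<lambda>y. cnj (f y)) x)"


definition time_limiting :: "'a set \<Rightarrow> ('a \<Rightarrow> complex) \<Rightarrow> 'a \<Rightarrow> complex" where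
  "time_limiting A f = (\<lambda>x. indicator A x * f x)"

definition band_limiting ::
    "'a measure \<Rightarrow> (('a \<Rightarrow> complex) \<Rightarrow> 'a \<Rightarrow> complex) \<Rightarrow> 'a set \<Rightarrow> ('a \<Rightarrow> complex) \<Rightarrow> 'a \<Rightarrow> complex" where
  "band_limiting M U A f = L2_inverse M U (\<lambda>\<xi>. indicator A \<xi> * U f \<xi>)"

definition localization_op ::
    "'a measure \<Rightarrow> (('a \<Rightarrow> complex) \<Rightarrow> 'a \<Rightarrow> complex) \<Rightarrow> 'a set \<Rightarrow> 'a set \<Rightarrow>
      ('a \<Rightarrow> complex) \<Rightarrow> 'a \<Rightarrow> complex" where
  "localization_op M U S W f = time_limiting S (band_limiting M U W (time_limiting S f))"

definition L2_concentrated ::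
    "'a measure \<Rightarrow> (('a \<Rightarrow> complex) \<Rightarrow> 'a \<Rightarrow> complex) \<Rightarrow> real \<Rightarrow> real \<Rightarrow> 'a set \<Rightarrow> 'a set \<Rightarrow>
      ('a \<Rightarrow> complex) set" where
  "L2_concentrated M U \<epsilon>\<^sub>1 \<epsilon>\<^sub>2 S W =
     {f \<in> L2 M. \<not> (AE x in M. f x = 0) \<and>
        L2_norm M (time_limiting (space M - S) f) \<le> \<epsilon>\<^sub>1 * L2_norm M f \<and>
        L2_norm M (band_limiting M U (space M - W) f) \<le> \<epsilon>\<^sub>2 * L2_norm M f}"

definition localized_wrt ::
    "'a measure \<Rightarrow> (('a \<Rightarrow> complex) \<Rightarrow> 'a \<Rightarrow> complex) \<Rightarrow> real \<Rightarrow> ('a \<Rightarrow> complex) \<Rightarrow> bool" where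
  "localized_wrt M L \<epsilon> f \<longleftrightarrow>
     f \<in> L2 M \<and> \<not> (AE x in M. f x = 0) \<and> L2_norm M (\<lambda>x. L f x - f x) \<le> \<epsilon> * L2_norm M f"

text \<open>
  The index set \<open>I\<close> is the set of all positive integers, or \<open>{1..m}\<close> if \<open>L\<close> has finite rank \<open>m\<close>. By
  the expansion, which converges in the norm of the space, every positive eigenvalue of \<open>L\<close> is
  listed as often as its multiplicity.
\<close>

definition spectral_system ::
    "'a measure \<Rightarrow> (('a \<Rightarrow> complex) \<Rightarrow> 'a \<Rightarrow> complex) \<Rightarrow>
      nat set \<Rightarrow> (nat \<Rightarrow> real) \<Rightarrow> (nat \<Rightarrow> 'a \<Rightarrow> complex) \<Rightarrow> bool" where
  "spectral_system M L I ev \<phi> \<longleftrightarrow>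
     (I = {1..} \<or> (\<exists>m. I = {1..m})) \<and>
     (\<forall>n\<in>I. ev n > 0) \<and>
     (\<forall>m\<in>I. \<forall>n\<in>I. m \<le> n \<longrightarrow> ev n \<le> ev m) \<and>
     (\<forall>n\<in>I. \<phi> n \<in> L2 M) \<and>
     (\<forall>m\<in>I. \<forall>n\<in>I. L2_inner M (\<phi> m) (\<phi> n) = (if m = n then 1 else 0)) \<and>
     (\<forall>n\<in>I. AE x in M. L (\<phi> n) x = of_real (ev n) * \<phi> n x) \<and>
     (\<forall>f\<in>L2 M.
        (\<lambda>N. L2_norm M
           (\<lambda>x. L f x - (\<Sum>n\<in>I \<inter> {1..N}. of_real (ev n) * L2_inner M f (\<phi> n) * \<phi> n x)))
        \<longlonglongrightarrow> 0)"

definition eigenvalue_count :: "nat set \<Rightarrow> (nat \<Rightarrow> real) \<Rightarrow> real \<Rightarrow> nat" where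
  "eigenvalue_count I ev \<epsilon>\<^sub>0 = card {n \<in> I. ev n \<ge> 1 - \<epsilon>\<^sub>0}"

end

theory Submission
  imports Defs
begin

text \<open>
  Put \<open>q(f) = \<langle>Lf, f\<rangle> = \<parallel>\<chi>\<^sub>\<Sigma> U(\<chi>\<^sub>S f)\<parallel>\<^sup>2\<close> and let \<open>P\<close> be the orthogonal projection onto the span of the
  eigenfunctions with eigenvalue at least \<open>1 - \<epsilon>\<^sub>0\<close>. As all eigenvalues are at most \<open>1\<close>, the expansion of
  \<open>L\<close> and the Bessel inequality give \<open>q(f) \<le> \<parallel>Pf\<parallel>\<^sup>2 + (1 - \<epsilon>\<^sub>0) \<parallel>f - Pf\<parallel>\<^sup>2\<close>, that is,
  \<open>\<epsilon>\<^sub>0 \<parallel>f - Pf\<parallel>\<^sup>2 \<le> \<parallel>f\<parallel>\<^sup>2 - q(f)\<close>. Both kinds of localization bound the right-hand side. Only finitely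
  many eigenvalues are at least \<open>1 - \<epsilon>\<^sub>0\<close>: on functions supported in \<open>S\<close> the operator \<open>U\<close> has the bounded
  kernel \<open>K\<close>, and the Bessel inequality for \<open>K(\<cdot>, \<xi>)\<close>, integrated over \<open>\<xi> \<in> \<Sigma>\<close>, bounds the trace of \<open>L\<close>.
\<close>

section \<open>The space of square-integrable functions, its inner product and norm\<close>

lemma L2_measurable: "f \<in> L2 M \<Longrightarrow> f \<in> borel_measurable M"
  and L2_integrable: "f \<in> L2 M \<Longrightarrow> integrable M (\<lambda>x. (cmod (f x))\<^sup>2)"
  by (auto simp: L2_def)

lemma L2I_dominated:
  assumes [measurable]: "f \<in> borel_measurable M"
    and "integrable M h" and "\<And>x. x \<in> space M \<Longrightarrow> (cmod (f x))\<^sup>2 \<le> h x"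
  shows "f \<in> L2 M"
proof -
  have "integrable M (\<lambda>x. (cmod (f x))\<^sup>2)"
    by (rule Bochner_Integration.integrable_bound[OF assms(2)]) (use assms(3) in \<open>force intro!: AE_I2\<close>)+
  then show ?thesis by (simp add: L2_def)
qed

lemma cmod_add_power2_le: "(cmod (a + b))\<^sup>2 \<le> 2 * (cmod a)\<^sup>2 + 2 * (cmod b)\<^sup>2"
proof -
  have "(cmod (a + b))\<^sup>2 \<le> (cmod a + cmod b)\<^sup>2"
    by (simp add: norm_triangle_ineq power_mono)
  also have "\<dots> \<le> 2 * (cmod a)\<^sup>2 + 2 * (cmod b)\<^sup>2"
    using zero_le_power2[of "cmod a - cmod b"] unfolding power2_sum power2_diff by linarith
  finally show ?thesis .
qed

lemma L2_add:
  assumes "f \<in> L2 M" "g \<in> L2 M"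
  shows "(\<lambda>x. f x + g x) \<in> L2 M"
proof -
  note [measurable] = L2_measurable[OF assms(1)] L2_measurable[OF assms(2)]
  show ?thesis
    by (rule L2I_dominated[where h = "\<lambda>x. 2 * (cmod (f x))\<^sup>2 + 2 * (cmod (g x))\<^sup>2"])
      (use assms in \<open>auto simp: L2_integrable cmod_add_power2_le\<close>)
qed

lemma borel_measurable_cnj:
  assumes "f \<in> borel_measurable M"
  shows "(\<lambda>x. cnj (f x)) \<in> borel_measurable M"
  using measurable_compose[OF assms borel_measurable_continuous_onI[OF continuous_on_cnj[OF continuous_on_id]]]
  by simp

lemma L2_cmult: "f \<in> L2 M \<Longrightarrow> (\<lambda>x. c * f x) \<in> L2 M"
  by (auto simp: L2_def norm_mult power_mult_distrib)

lemma L2_diff: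
  assumes "f \<in> L2 M" "g \<in> L2 M"
  shows "(\<lambda>x. f x - g x) \<in> L2 M"
  using L2_add[OF assms(1) L2_cmult[OF assms(2), of "-1"]] by simp

lemma L2_sum:
  assumes "finite J" "\<And>n. n \<in> J \<Longrightarrow> g n \<in> L2 M"
  shows "(\<lambda>x. \<Sum>n\<in>J. g n x) \<in> L2 M"
  using assms
proof (induction J rule: finite_induct)
  case empty
  then show ?case by (simp add: L2_def)
next
  case (insert n J)
  then show ?case using L2_add[of "g n" M "\<lambda>x. \<Sum>n\<in>J. g n x"] by simp
qed

lemma L2_indicator:
  assumes "f \<in> L2 M" "A \<in> sets M"
  shows "(\<lambda>x. indicator A x * f x) \<in> L2 M"
proof -
  note [measurable] = L2_measurable[OF assms(1)] assms(2)
  show ?thesis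
    by (rule L2I_dominated[OF _ L2_integrable[OF assms(1)]]) (auto split: split_indicator)
qed

lemma L2_inner_integrable:
  assumes "f \<in> L2 M" "g \<in> L2 M"
  shows "integrable M (\<lambda>x. f x * cnj (g x))"
proof -
  note [measurable] = L2_measurable[OF assms(1)] borel_measurable_cnj[OF L2_measurable[OF assms(2)]]
  have "cmod a * cmod b \<le> (cmod a)\<^sup>2 + (cmod b)\<^sup>2" for a b
    using zero_le_power2[of "cmod a - cmod b"] zero_le_power2[of "cmod a"] zero_le_power2[of "cmod b"]
    unfolding power2_diff by linarith
  then show ?thesis
    by (intro Bochner_Integration.integrable_bound[OF
          Bochner_Integration.integrable_add[OF assms[THEN L2_integrable]]])
      (auto simp: norm_mult)
qed

lemma L2_inner_diff_left:
  assumes "f \<in> L2 M" "g \<in> L2 M" "h \<in> L2 M"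
  shows "L2_inner M (\<lambda>x. f x - g x) h = L2_inner M f h - L2_inner M g h"
  using assms by (simp add: L2_inner_def left_diff_distrib L2_inner_integrable)

lemma L2_inner_cmult_left: "L2_inner M (\<lambda>x. c * f x) h = c * L2_inner M f h"
  by (simp add: L2_inner_def mult.assoc)

lemma L2_inner_sum_left:
  assumes "\<And>n. n \<in> J \<Longrightarrow> g n \<in> L2 M" "h \<in> L2 M"
  shows "L2_inner M (\<lambda>x. \<Sum>n\<in>J. g n x) h = (\<Sum>n\<in>J. L2_inner M (g n) h)"
  using assms by (simp add: L2_inner_def sum_distrib_right L2_inner_integrable)

lemma L2_inner_commute: "L2_inner M g f = cnj (L2_inner M f g)"
  unfolding L2_inner_def by (subst Bochner_Integration.integral_cnj[symmetric]) (simp add: mult.commute)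

lemma L2_inner_cong_AE:
  assumes "AE x in M. f x = f' x" "f \<in> L2 M" "f' \<in> L2 M" "g \<in> L2 M"
  shows "L2_inner M f g = L2_inner M f' g"
proof -
  note [measurable] = assms(2,3)[THEN L2_measurable] borel_measurable_cnj[OF L2_measurable[OF assms(4)]]
  show ?thesis
    unfolding L2_inner_def by (rule integral_cong_AE) (use assms(1) in auto)
qed

lemma L2_norm_nonneg: "L2_norm M f \<ge> 0"
  by (simp add: L2_norm_def)

lemma L2_norm_power2: "(L2_norm M f)\<^sup>2 = (\<integral>x. (cmod (f x))\<^sup>2 \<partial>M)"
  by (simp add: L2_norm_def)

lemma L2_inner_self: "L2_inner M f f = of_real ((L2_norm M f)\<^sup>2)"
  unfolding L2_norm_power2 L2_inner_def
  by (simp only: complex_norm_square[symmetric] integral_complex_of_real)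

lemma L2_norm_diff_power2:
  assumes "f \<in> L2 M" "g \<in> L2 M"
  shows "(L2_norm M (\<lambda>x. f x - g x))\<^sup>2 =
    (L2_norm M f)\<^sup>2 - 2 * Re (L2_inner M f g) + (L2_norm M g)\<^sup>2"
proof -
  have "complex_of_real ((L2_norm M (\<lambda>x. f x - g x))\<^sup>2) =
      L2_inner M f (\<lambda>x. f x - g x) - L2_inner M g (\<lambda>x. f x - g x)"
    by (simp only: L2_inner_self[symmetric] L2_inner_diff_left[OF assms L2_diff[OF assms]])
  \<comment> \<open>Linearity is available in the left argument only, so the right one is expanded
    through conjugate symmetry.\<close>
  also have "\<dots> = cnj (L2_inner M f f - L2_inner M g f) - cnj (L2_inner M f g - L2_inner M g g)"
    by (simp only: L2_inner_commute[of M _ "\<lambda>x. f x - g x"] L2_inner_diff_left assms)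
  also have "\<dots> = of_real ((L2_norm M f)\<^sup>2 + (L2_norm M g)\<^sup>2) - (L2_inner M f g + cnj (L2_inner M f g))"
    by (simp add: L2_inner_self L2_inner_commute[of M g f])
  also have "\<dots> = of_real ((L2_norm M f)\<^sup>2 - 2 * Re (L2_inner M f g) + (L2_norm M g)\<^sup>2)"
    by (simp add: complex_add_cnj)
  finally show ?thesis by (simp only: of_real_eq_iff)
qed

lemma L2_norm_cmult: "L2_norm M (\<lambda>x. c * f x) = cmod c * L2_norm M f"
  by (simp add: L2_norm_def norm_mult power_mult_distrib real_sqrt_mult)

lemma L2_norm_eq_0:
  assumes "f \<in> L2 M" "L2_norm M f = 0"
  shows "AE x in M. f x = 0"
  using assms integral_nonneg_eq_0_iff_AE[of M "\<lambda>x. (cmod (f x))\<^sup>2"]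
  by (simp add: L2_norm_def L2_integrable)

text \<open>For nonzero norms \<open>s\<close> of \<open>f\<close> and \<open>t\<close> of
  \<open>g\<close>, the squared norm of \<open>t f - s g\<close> is
  \<open>2 s t (s t - Re (L2_inner M f g))\<close>, and it is nonnegative. If one norm vanishes, the
  integrand vanishes almost everywhere.\<close>

lemma L2_Cauchy_Schwarz:
  assumes f: "f \<in> L2 M" and g: "g \<in> L2 M"
  shows "Re (L2_inner M f g) \<le> L2_norm M f * L2_norm M g"
proof (cases "L2_norm M f = 0 \<or> L2_norm M g = 0")
  case True
  then have "AE x in M. f x * cnj (g x) = 0"
    using L2_norm_eq_0[OF f] L2_norm_eq_0[OF g] by auto
  then have "L2_inner M f g = 0"
    unfolding L2_inner_def by (rule integral_eq_zero_AE)
  then show ?thesis by (simp add: L2_norm_nonneg)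
next
  case False
  define s t where "s = L2_norm M f" and "t = L2_norm M g"
  have pos: "s > 0" "t > 0"
    using False L2_norm_nonneg[of M f] L2_norm_nonneg[of M g] by (auto simp: s_def t_def)
  have inner: "L2_inner M (\<lambda>x. of_real t * f x) (\<lambda>x. of_real s * g x) = of_real (s * t) * L2_inner M f g"
    by (simp add: L2_inner_cmult_left L2_inner_commute[of M _ "\<lambda>x. of_real s * g x"]
        L2_inner_commute[of M g f] mult_ac)
  have "0 \<le> (L2_norm M (\<lambda>x. of_real t * f x - of_real s * g x))\<^sup>2"
    by simp
  also have "\<dots> = 2 * (s * t) * (s * t - Re (L2_inner M f g))"
    unfolding L2_norm_diff_power2[OF L2_cmult[OF f] L2_cmult[OF g]] inner L2_norm_cmult
      s_def[symmetric] t_def[symmetric]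
    using pos by (simp add: power2_eq_square algebra_simps)
  finally have "s * t - Re (L2_inner M f g) \<ge> 0"
    using pos mult_pos_pos[OF pos] by (simp only: zero_le_mult_iff) auto
  then show ?thesis by (simp add: s_def t_def)
qed

lemma L2_norm_indicator_le:
  assumes "f \<in> L2 M" "A \<in> sets M"
  shows "L2_norm M (\<lambda>x. indicator A x * f x) \<le> L2_norm M f"
  unfolding L2_norm_def real_sqrt_le_iff
  by (rule integral_mono)
    (use L2_integrable[OF assms(1)] L2_integrable[OF L2_indicator[OF assms]]
      in \<open>auto split: split_indicator\<close>)

lemma L2_inner_indicator_left:
  "L2_inner M (\<lambda>x. indicator A x * f x) g = L2_inner M f (\<lambda>x. indicator A x * g x)"
  unfolding L2_inner_def
  by (rule Bochner_Integration.integral_cong) (auto split: split_indicator)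

lemma L2_inner_indicator_self:
  "L2_inner M (\<lambda>x. indicator A x * f x) f = of_real ((L2_norm M (\<lambda>x. indicator A x * f x))\<^sup>2)"
proof -
  have "L2_inner M (\<lambda>x. indicator A x * f x) f =
      L2_inner M (\<lambda>x. indicator A x * f x) (\<lambda>x. indicator A x * f x)"
    unfolding L2_inner_def
    by (rule Bochner_Integration.integral_cong) (auto split: split_indicator)
  then show ?thesis by (simp add: L2_inner_self)
qed

lemma L2_norm_indicator_Compl:
  assumes f: "f \<in> L2 M" and A: "A \<in> sets M"
  shows "(L2_norm M (\<lambda>x. indicator A x * f x))\<^sup>2 + (L2_norm M (\<lambda>x. indicator (space M - A) x * f x))\<^sup>2
    = (L2_norm M f)\<^sup>2"
proof -
  have B: "space M - A \<in> sets M" using A by auto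
  show ?thesis
    unfolding L2_norm_power2
    by (subst Bochner_Integration.integral_add[symmetric])
      (auto intro!: Bochner_Integration.integral_cong L2_integrable L2_indicator f A B
        split: split_indicator)
qed

section \<open>Orthonormal families and the Bessel inequality\<close>

definition orthonormal :: "'a measure \<Rightarrow> 'b set \<Rightarrow> ('b \<Rightarrow> 'a \<Rightarrow> complex) \<Rightarrow> bool" where
  "orthonormal M J \<phi> \<longleftrightarrow> (\<forall>n\<in>J. \<phi> n \<in> L2 M) \<and>
     (\<forall>m\<in>J. \<forall>n\<in>J. L2_inner M (\<phi> m) (\<phi> n) = (if m = n then 1 else 0))"

lemma orthonormal_subset: "orthonormal M I \<phi> \<Longrightarrow> J \<subseteq> I \<Longrightarrow> orthonormal M J \<phi>"
  unfolding orthonormal_def by blast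

text \<open>Pythagoras: with \<open>P\<close> the projection of \<open>f\<close>, both the inner
  product of \<open>P\<close> with \<open>f\<close> and the squared norm of \<open>P\<close> equal
  the sum \<open>A\<close> of the squared moduli of the coefficients.\<close>

lemma L2_norm_diff_projection:
  assumes J: "finite J" and on: "orthonormal M J \<phi>" and f: "f \<in> L2 M"
  shows "(L2_norm M (\<lambda>x. f x - (\<Sum>n\<in>J. L2_inner M f (\<phi> n) * \<phi> n x)))\<^sup>2 =
    (L2_norm M f)\<^sup>2 - (\<Sum>n\<in>J. (cmod (L2_inner M f (\<phi> n)))\<^sup>2)"
proof -
  define c where "c n = L2_inner M f (\<phi> n)" for n
  define P where "P = (\<lambda>x. \<Sum>n\<in>J. c n * \<phi> n x)"
  define A where "A = (\<Sum>n\<in>J. (cmod (c n))\<^sup>2)"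
  have mem: "(\<lambda>x. c n * \<phi> n x) \<in> L2 M" if "n \<in> J" for n
    using that on by (simp add: orthonormal_def L2_cmult)
  have P: "P \<in> L2 M"
    unfolding P_def by (rule L2_sum[OF J mem])
  have P_inner: "L2_inner M P h = (\<Sum>n\<in>J. c n * L2_inner M (\<phi> n) h)" if "h \<in> L2 M" for h
    unfolding P_def by (simp add: L2_inner_sum_left[OF mem that] L2_inner_cmult_left)
  have sq: "c n * cnj (c n) = of_real ((cmod (c n))\<^sup>2)" for n
    by (rule complex_norm_square[symmetric])
  have "L2_inner M P f = (\<Sum>n\<in>J. c n * cnj (c n))"
    unfolding P_inner[OF f] c_def by (simp add: L2_inner_commute[of M _ f])
  then have Pf: "L2_inner M P f = of_real A"
    by (simp add: sq A_def)
  have "L2_inner M P (\<phi> m) = c m" if "m \<in> J" for m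
  proof -
    have "L2_inner M P (\<phi> m) = (\<Sum>n\<in>J. if n = m then c m else 0)"
      using that on by (subst P_inner) (auto simp: orthonormal_def intro!: sum.cong)
    then show ?thesis using J that by simp
  qed
  then have "L2_inner M P P = (\<Sum>n\<in>J. c n * cnj (c n))"
    unfolding P_inner[OF P] by (intro sum.cong) (auto simp: L2_inner_commute[of M _ P])
  then have "complex_of_real ((L2_norm M P)\<^sup>2) = of_real A"
    by (simp only: sq A_def of_real_sum flip: L2_inner_self)
  then have "(L2_norm M P)\<^sup>2 = A"
    by (simp only: of_real_eq_iff)
  then have "(L2_norm M (\<lambda>x. f x - P x))\<^sup>2 = (L2_norm M f)\<^sup>2 - A"
    unfolding L2_norm_diff_power2[OF f P] by (simp add: L2_inner_commute[of M f P] Pf)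
  then show ?thesis by (simp add: P_def A_def c_def)
qed

lemma Bessel_inequality:
  assumes "finite J" "orthonormal M J \<phi>" "f \<in> L2 M"
  shows "(\<Sum>n\<in>J. (cmod (L2_inner M f (\<phi> n)))\<^sup>2) \<le> (L2_norm M f)\<^sup>2"
  using L2_norm_diff_projection[OF assms]
    zero_le_power2[of "L2_norm M (\<lambda>x. f x - (\<Sum>n\<in>J. L2_inner M f (\<phi> n) * \<phi> n x))"]
  by linarith

text \<open>On a set of finite measure the indicator is itself square-integrable, so its product
  with \<open>f\<close> is integrable. This makes the kernel formula for \<open>U\<close> applicable
  to time-limited functions.\<close>

lemma integrable_time_limiting:
  assumes f: "f \<in> L2 M" and A: "A \<in> sets M" "emeasure M A < \<infinity>"
  shows "integrable M (time_limiting A f)"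
proof -
  have "(\<lambda>x. indicator A x) \<in> L2 M"
    by (rule L2I_dominated[where h = "indicator A"])
      (use A in \<open>auto split: split_indicator\<close>)
  from L2_inner_integrable[OF f this] show ?thesis
    unfolding time_limiting_def
    by (rule Bochner_Integration.integrable_cong[THEN iffD1, rotated 2]) (auto split: split_indicator)
qed

lemma L2_time_limiting: "f \<in> L2 M \<Longrightarrow> A \<in> sets M \<Longrightarrow> time_limiting A f \<in> L2 M"
  unfolding time_limiting_def by (rule L2_indicator)

section \<open>Unitary operators on functions taken up to null sets\<close>

lemma unitary_on_L2_closed: "unitary_on_L2 M U \<Longrightarrow> f \<in> L2 M \<Longrightarrow> U f \<in> L2 M"
  by (simp add: unitary_on_L2_def)

lemma unitary_on_L2_inner:
  "unitary_on_L2 M U \<Longrightarrow> f \<in> L2 M \<Longrightarrow> g \<in> L2 M \<Longrightarrow> L2_inner M (U f) (U g) = L2_inner M f g"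
  by (simp add: unitary_on_L2_def)

lemma unitary_on_L2_add:
  "unitary_on_L2 M U \<Longrightarrow> f \<in> L2 M \<Longrightarrow> g \<in> L2 M \<Longrightarrow> AE x in M. U (\<lambda>y. f y + g y) x = U f x + U g x"
  by (simp add: unitary_on_L2_def)

lemma unitary_on_L2_norm:
  assumes "unitary_on_L2 M U" "f \<in> L2 M"
  shows "L2_norm M (U f) = L2_norm M f"
proof -
  have "complex_of_real ((L2_norm M (U f))\<^sup>2) = of_real ((L2_norm M f)\<^sup>2)"
    using unitary_on_L2_inner[OF assms assms(2)] by (simp only: L2_inner_self)
  then have "(L2_norm M (U f))\<^sup>2 = (L2_norm M f)\<^sup>2"
    by (simp only: of_real_eq_iff)
  then show ?thesis
    by (simp add: L2_norm_nonneg power2_eq_iff_nonneg)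
qed

text \<open>Surjectivity of \<open>U\<close> up to null sets provides the witness that
  \<open>SOME\<close> selects.\<close>

lemma L2_inverse:
  assumes "unitary_on_L2 M U" "g \<in> L2 M"
  shows "L2_inverse M U g \<in> L2 M" "AE x in M. U (L2_inverse M U g) x = g x"
proof -
  have "\<exists>f. f \<in> L2 M \<and> (AE x in M. U f x = g x)"
    using assms unfolding unitary_on_L2_def by blast
  from someI_ex[OF this] show "L2_inverse M U g \<in> L2 M" "AE x in M. U (L2_inverse M U g) x = g x"
    by (auto simp: L2_inverse_def)
qed

lemma L2_norm_cong_AE:
  assumes "AE x in M. f x = f' x" "f \<in> L2 M" "f' \<in> L2 M"
  shows "L2_norm M f = L2_norm M f'"
proof -
  note [measurable] = assms(2-3)[THEN L2_measurable]
  show ?thesis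
    unfolding L2_norm_def by (rule arg_cong[where f = sqrt], rule integral_cong_AE) (use assms(1) in auto)
qed

text \<open>Since \<open>U\<close> acts on functions and not on classes, this has to be derived:
  \<open>g - f\<close> has norm 0, hence so does its image by isometry, and additivity transfers
  this to \<open>U f\<close> and \<open>U g\<close>.\<close>

lemma unitary_on_L2_cong_AE:
  assumes U: "unitary_on_L2 M U" and f: "f \<in> L2 M" and g: "g \<in> L2 M" and eq: "AE x in M. f x = g x"
  shows "AE x in M. U f x = U g x"
proof -
  let ?d = "\<lambda>y. g y - f y"
  have d: "?d \<in> L2 M" using g f by (rule L2_diff)
  have "AE x in M. ?d x = 0" using eq by eventually_elim simp
  then have "L2_norm M ?d = L2_norm M (\<lambda>x. 0)"
    by (rule L2_norm_cong_AE) (use d in \<open>auto simp: L2_def\<close>)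
  then have "L2_norm M (U ?d) = 0"
    using unitary_on_L2_norm[OF U d] by (simp add: L2_norm_def)
  with unitary_on_L2_closed[OF U d] have "AE x in M. U ?d x = 0"
    by (rule L2_norm_eq_0)
  moreover have "AE x in M. U (\<lambda>y. f y + ?d y) x = U f x + U ?d x"
    by (rule unitary_on_L2_add[OF U f d])
  ultimately show ?thesis
    by eventually_elim simp
qed

section \<open>Time and band limiting, and the quadratic form of the localization operator\<close>

context
  fixes M :: "'a measure" and U and S \<Sigma> :: "'a set"
  assumes unitary: "unitary_on_L2 M U" and S: "S \<in> sets M" and \<Sigma>: "\<Sigma> \<in> sets M"
begin

lemma L2_band_limiting:
  assumes "f \<in> L2 M" "A \<in> sets M"
  shows "band_limiting M U A f \<in> L2 M"
  unfolding band_limiting_def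
  by (intro L2_inverse unitary L2_indicator unitary_on_L2_closed[OF unitary] assms)

lemma band_limiting_AE:
  assumes "f \<in> L2 M" "A \<in> sets M"
  shows "AE x in M. U (band_limiting M U A f) x = indicator A x * U f x"
  unfolding band_limiting_def
  by (intro L2_inverse unitary L2_indicator unitary_on_L2_closed[OF unitary] assms)

text \<open>The isometry \<open>U\<close> turns band limiting into multiplication by an
  indicator.\<close>

lemma L2_norm_band_limiting:
  assumes "f \<in> L2 M" "A \<in> sets M"
  shows "L2_norm M (band_limiting M U A f) = L2_norm M (\<lambda>x. indicator A x * U f x)"
proof -
  have "L2_norm M (band_limiting M U A f) = L2_norm M (U (band_limiting M U A f))"
    by (simp add: unitary_on_L2_norm[OF unitary] L2_band_limiting assms)
  also have "\<dots> = L2_norm M (\<lambda>x. indicator A x * U f x)"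
    by (intro L2_norm_cong_AE band_limiting_AE L2_indicator L2_band_limiting
        unitary_on_L2_closed[OF unitary] assms)
  finally show ?thesis .
qed

lemma L2_localization_op: "f \<in> L2 M \<Longrightarrow> localization_op M U S \<Sigma> f \<in> L2 M"
  unfolding localization_op_def by (intro L2_time_limiting L2_band_limiting S \<Sigma>)

text \<open>This is the inner product of \<open>localization_op M U S \<Sigma> f\<close> with
  \<open>f\<close>, written as a squared norm so that it is real and comparable with the norm of
  \<open>f\<close>.\<close>

definition quad_form :: "('a \<Rightarrow> complex) \<Rightarrow> real" where
  "quad_form f = (L2_norm M (\<lambda>x. indicator \<Sigma> x * U (time_limiting S f) x))\<^sup>2"

text \<open>The outer cutoff to \<open>S\<close> moves to the right argument; applying
  \<open>U\<close> to both sides then replaces band limiting by the indicator of \<Sigma>.\<close>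

lemma localization_op_inner:
  assumes f: "f \<in> L2 M"
  shows "L2_inner M (localization_op M U S \<Sigma> f) f = of_real (quad_form f)"
proof -
  let ?g = "time_limiting S f"
  have g: "?g \<in> L2 M" using f S by (rule L2_time_limiting)
  have "L2_inner M (localization_op M U S \<Sigma> f) f = L2_inner M (band_limiting M U \<Sigma> ?g) ?g"
    unfolding localization_op_def time_limiting_def by (rule L2_inner_indicator_left)
  also have "\<dots> = L2_inner M (U (band_limiting M U \<Sigma> ?g)) (U ?g)"
    by (rule unitary_on_L2_inner[OF unitary L2_band_limiting[OF g \<Sigma>] g, symmetric])
  also have "\<dots> = L2_inner M (\<lambda>x. indicator \<Sigma> x * U ?g x) (U ?g)"
    by (intro L2_inner_cong_AE band_limiting_AE L2_indicator L2_band_limiting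
        unitary_on_L2_closed[OF unitary] g \<Sigma>)
  finally show ?thesis by (simp only: L2_inner_indicator_self quad_form_def)
qed

lemma quad_form_le: "f \<in> L2 M \<Longrightarrow> quad_form f \<le> (L2_norm M f)\<^sup>2"
proof -
  assume f: "f \<in> L2 M"
  note g = L2_time_limiting[OF f S]
  have "L2_norm M (\<lambda>x. indicator \<Sigma> x * U (time_limiting S f) x) \<le> L2_norm M (U (time_limiting S f))"
    by (intro L2_norm_indicator_le unitary_on_L2_closed[OF unitary] g \<Sigma>)
  also have "\<dots> = L2_norm M (time_limiting S f)"
    by (rule unitary_on_L2_norm[OF unitary g])
  also have "\<dots> \<le> L2_norm M f"
    unfolding time_limiting_def by (intro L2_norm_indicator_le f S)
  finally show ?thesis
    unfolding quad_form_def by (intro power_mono L2_norm_nonneg)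
qed

text \<open>The left-hand side is the real part of the inner product of \<open>f - L f\<close> with
  \<open>f\<close>, where \<open>L\<close> is the localization operator; Cauchy-Schwarz bounds
  it.\<close>

lemma localized_quad_form:
  assumes "localized_wrt M (localization_op M U S \<Sigma>) \<epsilon> f"
  shows "(L2_norm M f)\<^sup>2 - quad_form f \<le> \<epsilon> * (L2_norm M f)\<^sup>2"
proof -
  let ?L = "localization_op M U S \<Sigma> f"
  from assms have f: "f \<in> L2 M" and le: "L2_norm M (\<lambda>x. ?L x - f x) \<le> \<epsilon> * L2_norm M f"
    by (auto simp: localized_wrt_def)
  note L = L2_localization_op[OF f]
  have "(L2_norm M f)\<^sup>2 - quad_form f = Re (L2_inner M (\<lambda>x. (-1) * (?L x - f x)) f)"
    unfolding L2_inner_cmult_left L2_inner_diff_left[OF L f f] localization_op_inner[OF f]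
    by (simp add: L2_inner_self)
  also have "\<dots> \<le> L2_norm M (\<lambda>x. (-1) * (?L x - f x)) * L2_norm M f"
    by (intro L2_Cauchy_Schwarz L2_cmult L2_diff L f)
  also have "\<dots> \<le> \<epsilon> * L2_norm M f * L2_norm M f"
    unfolding L2_norm_cmult using le by (simp add: L2_norm_nonneg mult_right_mono)
  finally show ?thesis by (simp add: power2_eq_square mult.assoc)
qed

text \<open>Split \<open>f\<close> into its part \<open>?g\<close> on \<open>S\<close> and its part
  \<open>?h\<close> off \<open>S\<close>. With \<open>w\<close> and \<open>z\<close> the
  restrictions of \<open>U f\<close> and \<open>U ?h\<close> to \<Sigma>, the form is the squared
  norm of \<open>w - z\<close>. Band concentration keeps \<open>w\<close> large, time concentration
  keeps \<open>z\<close> small, and the cross term contributes the factor 2.\<close>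

lemma concentrated_quad_form:
  assumes conc: "f \<in> L2_concentrated M U \<epsilon>\<^sub>1 \<epsilon>\<^sub>2 S \<Sigma>" and \<epsilon>: "0 \<le> \<epsilon>\<^sub>2" "\<epsilon>\<^sub>2 \<le> 1"
  shows "(L2_norm M f)\<^sup>2 - quad_form f \<le> (2 * \<epsilon>\<^sub>1 + \<epsilon>\<^sub>2) * (L2_norm M f)\<^sup>2"
proof -
  let ?N = "L2_norm M f" and ?g = "time_limiting S f" and ?h = "time_limiting (space M - S) f"
  have f: "f \<in> L2 M" and h_le: "L2_norm M ?h \<le> \<epsilon>\<^sub>1 * ?N"
    and band: "L2_norm M (band_limiting M U (space M - \<Sigma>) f) \<le> \<epsilon>\<^sub>2 * ?N"
    using conc by (auto simp: L2_concentrated_def)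
  have Sc: "space M - S \<in> sets M" and \<Sigma>c: "space M - \<Sigma> \<in> sets M"
    using S \<Sigma> by auto
  note g = L2_time_limiting[OF f S] and h = L2_time_limiting[OF f Sc]
  note U = unitary_on_L2_closed[OF unitary]
  define w where "w = (\<lambda>x. indicator \<Sigma> x * U f x)"
  define z where "z = (\<lambda>x. indicator \<Sigma> x * U ?h x)"
  have w: "w \<in> L2 M" and z: "z \<in> L2 M"
    unfolding w_def z_def by (intro L2_indicator U f h \<Sigma>)+
  have z_le: "L2_norm M z \<le> \<epsilon>\<^sub>1 * ?N"
    using L2_norm_indicator_le[OF U[OF h] \<Sigma>] unitary_on_L2_norm[OF unitary h] h_le
    by (simp add: z_def)
  have w_le: "L2_norm M w \<le> ?N"
    using L2_norm_indicator_le[OF U[OF f] \<Sigma>] unitary_on_L2_norm[OF unitary f] by (simp add: w_def)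
  have "(L2_norm M (band_limiting M U (space M - \<Sigma>) f))\<^sup>2 \<le> (\<epsilon>\<^sub>2 * ?N)\<^sup>2"
    by (intro power_mono band L2_norm_nonneg)
  \<comment> \<open>The square of \<open>\<epsilon>\<^sub>2\<close> is at most
    \<open>\<epsilon>\<^sub>2\<close>, as this number lies between 0 and 1.\<close>
  also have "\<dots> \<le> \<epsilon>\<^sub>2 * ?N\<^sup>2"
    using \<epsilon> mult_left_le[of \<epsilon>\<^sub>2 \<epsilon>\<^sub>2] unfolding power_mult_distrib
    by (intro mult_right_mono) (simp_all add: power2_eq_square)
  finally have w_ge: "(L2_norm M w)\<^sup>2 \<ge> ?N\<^sup>2 - \<epsilon>\<^sub>2 * ?N\<^sup>2"
    using L2_norm_indicator_Compl[OF U[OF f] \<Sigma>]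
    unfolding L2_norm_band_limiting[OF f \<Sigma>c] unitary_on_L2_norm[OF unitary f] w_def by linarith
  have "Re (L2_inner M w z) \<le> L2_norm M w * L2_norm M z"
    by (rule L2_Cauchy_Schwarz[OF w z])
  also have "\<dots> \<le> ?N * (\<epsilon>\<^sub>1 * ?N)"
    by (intro mult_mono w_le z_le L2_norm_nonneg)
  finally have wz: "Re (L2_inner M w z) \<le> \<epsilon>\<^sub>1 * ?N\<^sup>2"
    by (simp add: power2_eq_square mult_ac)
  have gh: "(\<lambda>y. ?g y + ?h y) \<in> L2 M"
    using g h by (rule L2_add)
  have "AE x in M. U (\<lambda>y. ?g y + ?h y) x = U ?g x + U ?h x"
    by (rule unitary_on_L2_add[OF unitary g h])
  moreover have "AE x in M. U (\<lambda>y. ?g y + ?h y) x = U f x"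
    \<comment> \<open>The two parts add up to \<open>f\<close> only on \<open>space M\<close>:
      outside it both indicators vanish while \<open>f\<close> is arbitrary.\<close>
    by (rule unitary_on_L2_cong_AE[OF unitary gh f], rule AE_I2)
      (simp add: time_limiting_def split: split_indicator)
  ultimately have AE: "AE x in M. indicator \<Sigma> x * U ?g x = w x - z x"
    by eventually_elim (auto simp: w_def z_def algebra_simps)
  have "quad_form f = (L2_norm M (\<lambda>x. w x - z x))\<^sup>2"
    unfolding quad_form_def
    by (subst L2_norm_cong_AE[OF AE]) (intro L2_indicator L2_diff U g w z \<Sigma> refl)+
  \<comment> \<open>The squared norm of \<open>z\<close> is dropped.\<close>
  also have "\<dots> \<ge> (L2_norm M w)\<^sup>2 - 2 * Re (L2_inner M w z)"
    by (simp add: L2_norm_diff_power2[OF w z])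
  finally show ?thesis using w_ge wz by (simp add: algebra_simps)
qed

section \<open>Eigenvalues and the trace bound\<close>

lemma eigenvalue_eq:
  assumes spec: "spectral_system M (localization_op M U S \<Sigma>) I ev \<phi>" and n: "n \<in> I"
  shows "ev n = quad_form (\<phi> n)"
proof -
  let ?L = "localization_op M U S \<Sigma>"
  have \<phi>: "\<phi> n \<in> L2 M" and norm: "L2_inner M (\<phi> n) (\<phi> n) = 1"
    and AE: "AE x in M. ?L (\<phi> n) x = of_real (ev n) * \<phi> n x"
    using spec n unfolding spectral_system_def by auto
  have "L2_inner M (?L (\<phi> n)) (\<phi> n) = L2_inner M (\<lambda>x. of_real (ev n) * \<phi> n x) (\<phi> n)"
    by (rule L2_inner_cong_AE[OF AE]) (intro L2_localization_op L2_cmult \<phi>)+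
  also have "\<dots> = of_real (ev n)"
    by (simp add: L2_inner_cmult_left norm)
  finally show ?thesis
    by (simp add: localization_op_inner \<phi>)
qed

text \<open>For fixed \<xi>, the values at \<xi> of the images under \<open>U\<close> of the
  time-limited \<open>\<phi> n\<close> are, up to conjugation, the coefficients of the single
  function \<open>k \<xi>\<close>. Bessel bounds the sum of their squares by the squared norm of
  \<open>k \<xi>\<close>, at most \<open>C\<^sup>2 * measure M S\<close>; integration over \<Sigma>
  gives the last factor.\<close>

lemma trace_bound:
  assumes kernel: "\<And>f. integrable M f \<Longrightarrow> f \<in> L2 M \<Longrightarrow> AE \<xi> in M. U f \<xi> = integral_op M K f \<xi>"
    and K_meas: "\<And>\<xi>. \<xi> \<in> space M \<Longrightarrow> (\<lambda>x. K x \<xi>) \<in> borel_measurable M"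
    and K_bound: "\<And>x \<xi>. x \<in> space M \<Longrightarrow> \<xi> \<in> space M \<Longrightarrow> cmod (K x \<xi>) \<le> C"
    and S_fin: "emeasure M S < \<infinity>" and \<Sigma>_fin: "emeasure M \<Sigma> < \<infinity>"
    and J: "finite J" and on: "orthonormal M J \<phi>"
  shows "(\<Sum>n\<in>J. quad_form (\<phi> n)) \<le> C\<^sup>2 * measure M S * measure M \<Sigma>"
proof -
  have \<phi>: "\<phi> n \<in> L2 M" if "n \<in> J" for n
    using on that by (simp add: orthonormal_def)
  define k where "k \<xi> = (\<lambda>x. indicator S x * cnj (K x \<xi>))" for \<xi>
  have k: "k \<xi> \<in> L2 M" "(L2_norm M (k \<xi>))\<^sup>2 \<le> C\<^sup>2 * measure M S" if \<xi>: "\<xi> \<in> space M" for \<xi>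
  proof -
    note [measurable] = borel_measurable_cnj[OF K_meas[OF \<xi>]] S
    have le: "(cmod (k \<xi> x))\<^sup>2 \<le> C\<^sup>2 * indicator S x" if "x \<in> space M" for x
      using power_mono[OF K_bound[OF that \<xi>], of 2] by (auto simp: k_def split: split_indicator)
    have int: "integrable M (\<lambda>x. C\<^sup>2 * indicator S x)"
      using S S_fin by simp
    show k: "k \<xi> \<in> L2 M"
      by (rule L2I_dominated[OF _ int le]) (simp_all add: k_def)
    have "(L2_norm M (k \<xi>))\<^sup>2 \<le> (\<integral>x. C\<^sup>2 * indicator S x \<partial>M)"
      unfolding L2_norm_power2 by (intro integral_mono L2_integrable k int le)
    then show "(L2_norm M (k \<xi>))\<^sup>2 \<le> C\<^sup>2 * measure M S"
      using S by simp
  qed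
  have AE: "AE \<xi> in M. U (time_limiting S (\<phi> n)) \<xi> = cnj (L2_inner M (k \<xi>) (\<phi> n))" if n: "n \<in> J" for n
  proof -
    have "integral_op M K (time_limiting S (\<phi> n)) \<xi> = cnj (L2_inner M (k \<xi>) (\<phi> n))" for \<xi>
      unfolding integral_op_def time_limiting_def k_def L2_inner_commute[symmetric]
      unfolding L2_inner_def by (rule Bochner_Integration.integral_cong) (auto split: split_indicator)
    then show ?thesis
      using kernel[OF integrable_time_limiting L2_time_limiting, OF \<phi>[OF n] S S_fin \<phi>[OF n] S] by simp
  qed
  define u where "u n = (\<lambda>\<xi>. indicator \<Sigma> \<xi> * U (time_limiting S (\<phi> n)) \<xi>)" for n
  have u: "integrable M (\<lambda>\<xi>. (cmod (u n \<xi>))\<^sup>2)" if "n \<in> J" for n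
    unfolding u_def
    by (intro L2_integrable L2_indicator unitary_on_L2_closed[OF unitary] L2_time_limiting \<phi> that S \<Sigma>)
  \<comment> \<open>As \<open>J\<close> is finite, one null set serves all indices, and Bessel can
    be applied at a single \<xi>.\<close>
  have "AE \<xi> in M. \<forall>n\<in>J. U (time_limiting S (\<phi> n)) \<xi> = cnj (L2_inner M (k \<xi>) (\<phi> n))"
    using J AE by (simp add: AE_finite_all)
  then have le: "AE \<xi> in M. (\<Sum>n\<in>J. (cmod (u n \<xi>))\<^sup>2) \<le> C\<^sup>2 * measure M S * indicator \<Sigma> \<xi>"
    using AE_space
  proof eventually_elim
    case (elim \<xi>)
    have "(\<Sum>n\<in>J. (cmod (u n \<xi>))\<^sup>2) = indicator \<Sigma> \<xi> * (\<Sum>n\<in>J. (cmod (L2_inner M (k \<xi>) (\<phi> n)))\<^sup>2)"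
      using elim(1) by (simp add: u_def split: split_indicator)
    also have "\<dots> \<le> indicator \<Sigma> \<xi> * (C\<^sup>2 * measure M S)"
      using order_trans[OF Bessel_inequality[OF J on k(1)] k(2)] elim(2)
      by (intro mult_left_mono) auto
    finally show ?case by (simp add: mult.commute)
  qed
  have "(\<Sum>n\<in>J. quad_form (\<phi> n)) = (\<integral>\<xi>. (\<Sum>n\<in>J. (cmod (u n \<xi>))\<^sup>2) \<partial>M)"
    using u by (simp add: quad_form_def L2_norm_power2 u_def)
  also have "\<dots> \<le> (\<integral>\<xi>. C\<^sup>2 * measure M S * indicator \<Sigma> \<xi> \<partial>M)"
    using u \<Sigma> \<Sigma>_fin le by (intro integral_mono_AE) auto
  also have "\<dots> = C\<^sup>2 * measure M S * measure M \<Sigma>"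
    using \<Sigma> by simp
  finally show ?thesis .
qed

section \<open>Projection onto the eigenfunctions with large eigenvalues\<close>

text \<open>In the eigenfunction expansion of the form, eigenvalues in \<open>J\<close> are replaced
  by 1 and all others by \<open>1 - \<epsilon>\<close>. By Bessel the form is then at most
  \<open>(1 - \<epsilon>)\<close> times the squared norm of \<open>f\<close> plus \<epsilon> times
  the squared norm of the projection; Pythagoras rewrites this as the claim.\<close>

lemma spectral_projection:
  assumes spec: "spectral_system M (localization_op M U S \<Sigma>) I ev \<phi>"
    and fin: "finite {n \<in> I. ev n \<ge> 1 - \<epsilon>}" and \<epsilon>: "0 < \<epsilon>" "\<epsilon> < 1" and f: "f \<in> L2 M"
  shows "\<epsilon> * (L2_norm M (\<lambda>x. f x - (\<Sum>n = 1..eigenvalue_count I ev \<epsilon>. L2_inner M f (\<phi> n) * \<phi> n x)))\<^sup>2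
    \<le> (L2_norm M f)\<^sup>2 - quad_form f"
proof -
  let ?L = "localization_op M U S \<Sigma>"
  define J where "J = {n \<in> I. ev n \<ge> 1 - \<epsilon>}"
  define c where "c n = L2_inner M f (\<phi> n)" for n
  have on: "orthonormal M I \<phi>"
    using spec unfolding spectral_system_def orthonormal_def by simp
  have \<phi>: "\<phi> n \<in> L2 M" if "n \<in> I" for n
    using on that by (simp add: orthonormal_def)
  have antimono: "ev n \<le> ev m" if "m \<in> I" "n \<in> I" "m \<le> n" for m n
    using spec that unfolding spectral_system_def by blast
  \<comment> \<open>The eigenvalues decrease and \<open>I\<close> has no gaps, so the finite set
    \<open>J\<close> is an initial segment, and its length is its cardinality. The empty case is the
    segment ending at 0.\<close>
  have J_eq: "J = {1..eigenvalue_count I ev \<epsilon>}"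
  proof -
    have I: "m \<in> I" if "n \<in> I" "1 \<le> m" "m \<le> n" for m n
      using spec that unfolding spectral_system_def by auto
    have pos: "1 \<le> n" if "n \<in> J" for n
      using spec that unfolding spectral_system_def J_def by auto
    have down: "m \<in> J" if "n \<in> J" "1 \<le> m" "m \<le> n" for m n
      using that I[of n m] antimono[of m n] by (force simp: J_def)
    have "\<exists>k. J = {1..k}"
    proof (cases "J = {}")
      case True
      then have "J = {1..0}" by simp
      then show ?thesis ..
    next
      case False
      moreover have "finite J" using fin by (simp add: J_def)
      ultimately have "Max J \<in> J" "\<forall>n. n \<in> J \<longrightarrow> n \<le> Max J"
        by simp_all
      then have "J = {1..Max J}"
        using down pos by (metis atLeastAtMost_iff subsetI subset_antisym)
      then show ?thesis ..
    qed
    then show ?thesis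
      by (auto simp: eigenvalue_count_def J_def[symmetric])
  qed
  have ev: "ev n = quad_form (\<phi> n)" if n: "n \<in> I" for n
    using spec n by (rule eigenvalue_eq)
  have ev_le: "ev n \<le> 1" if n: "n \<in> I" for n
  proof -
    have "complex_of_real ((L2_norm M (\<phi> n))\<^sup>2) = of_real 1"
      using on n unfolding L2_inner_self[symmetric] by (simp add: orthonormal_def)
    then have "(L2_norm M (\<phi> n))\<^sup>2 = 1"
      by (simp only: of_real_eq_iff)
    with quad_form_le[OF \<phi>[OF n]] show ?thesis by (simp add: ev n)
  qed
  define A where "A = (\<Sum>n\<in>J. (cmod (c n))\<^sup>2)"
  define R where "R N = (\<lambda>x. \<Sum>n\<in>I \<inter> {1..N}. of_real (ev n) * c n * \<phi> n x)" for N
  have R: "R N \<in> L2 M" for N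
    unfolding R_def by (rule L2_sum) (auto intro!: L2_cmult \<phi>)
  have R_inner: "Re (L2_inner M (R N) f) \<le> (1 - \<epsilon>) * (L2_norm M f)\<^sup>2 + \<epsilon> * A" for N
  proof -
    have "L2_inner M (R N) f = (\<Sum>n\<in>I \<inter> {1..N}. of_real (ev n) * (c n * cnj (c n)))"
      unfolding R_def using \<phi> f
      by (subst L2_inner_sum_left)
        (auto simp: L2_cmult L2_inner_cmult_left c_def L2_inner_commute[of M _ f] mult.assoc)
    then have "Re (L2_inner M (R N) f) = (\<Sum>n\<in>I \<inter> {1..N}. ev n * (cmod (c n))\<^sup>2)"
      by (simp add: cmod_power2 flip: power2_eq_square)
    also have "\<dots> \<le> (\<Sum>n\<in>I \<inter> {1..N}. (1 - \<epsilon>) * (cmod (c n))\<^sup>2 + (if n \<in> J then \<epsilon> * (cmod (c n))\<^sup>2 else 0))"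
    proof (rule sum_mono)
      fix n assume "n \<in> I \<inter> {1..N}"
      \<comment> \<open>On \<open>J\<close> the right-hand side is 1, which bounds every eigenvalue;
        off \<open>J\<close> the bound is the definition of \<open>J\<close>.\<close>
      then have "ev n \<le> (1 - \<epsilon>) + (if n \<in> J then \<epsilon> else 0)"
        using ev_le by (auto simp: J_def)
      then have "ev n * (cmod (c n))\<^sup>2 \<le> ((1 - \<epsilon>) + (if n \<in> J then \<epsilon> else 0)) * (cmod (c n))\<^sup>2"
        by (rule mult_right_mono) simp
      then show "ev n * (cmod (c n))\<^sup>2
          \<le> (1 - \<epsilon>) * (cmod (c n))\<^sup>2 + (if n \<in> J then \<epsilon> * (cmod (c n))\<^sup>2 else 0)"
        by (simp add: algebra_simps split: if_splits)
    qed
    also have "\<dots> = (1 - \<epsilon>) * (\<Sum>n\<in>I \<inter> {1..N}. (cmod (c n))\<^sup>2)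
        + \<epsilon> * (\<Sum>n\<in>I \<inter> {1..N} \<inter> J. (cmod (c n))\<^sup>2)"
      by (simp add: sum.distrib sum_distrib_left flip: sum.inter_restrict)
    \<comment> \<open>Bessel bounds the first sum; the second grows when extended to all of
      \<open>J\<close>.\<close>
    also have "\<dots> \<le> (1 - \<epsilon>) * (L2_norm M f)\<^sup>2 + \<epsilon> * A"
      unfolding A_def c_def using \<epsilon> fin
      by (intro add_mono mult_left_mono Bessel_inequality f sum_mono2 orthonormal_subset[OF on])
        (auto simp: J_def)
    finally show ?thesis .
  qed
  have "(\<lambda>N. L2_norm M (\<lambda>x. ?L f x - R N x)) \<longlonglongrightarrow> 0"
    using spec f unfolding spectral_system_def R_def c_def by blast
  \<comment> \<open>The last summand is the Cauchy-Schwarz bound for the truncation error of the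
    expansion. The estimate holds for every \<open>N\<close> and passes to the limit.\<close>
  then have lim: "(\<lambda>N. (1 - \<epsilon>) * (L2_norm M f)\<^sup>2 + \<epsilon> * A + L2_norm M (\<lambda>x. ?L f x - R N x) * L2_norm M f)
      \<longlonglongrightarrow> (1 - \<epsilon>) * (L2_norm M f)\<^sup>2 + \<epsilon> * A + 0 * L2_norm M f"
    by (intro tendsto_intros)
  have "quad_form f \<le> (1 - \<epsilon>) * (L2_norm M f)\<^sup>2 + \<epsilon> * A + L2_norm M (\<lambda>x. ?L f x - R N x) * L2_norm M f" for N
  proof -
    note L = L2_localization_op[OF f]
    have "quad_form f - Re (L2_inner M (R N) f) = Re (L2_inner M (\<lambda>x. ?L f x - R N x) f)"
      unfolding L2_inner_diff_left[OF L R f] localization_op_inner[OF f] by simp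
    also have "\<dots> \<le> L2_norm M (\<lambda>x. ?L f x - R N x) * L2_norm M f"
      by (intro L2_Cauchy_Schwarz L2_diff L R f)
    finally show ?thesis using R_inner[of N] by linarith
  qed
  with lim have "quad_form f \<le> (1 - \<epsilon>) * (L2_norm M f)\<^sup>2 + \<epsilon> * A + 0 * L2_norm M f"
    by (intro LIMSEQ_le_const[OF lim]) blast
  moreover have "(L2_norm M (\<lambda>x. f x - (\<Sum>n = 1..eigenvalue_count I ev \<epsilon>. L2_inner M f (\<phi> n) * \<phi> n x)))\<^sup>2
      = (L2_norm M f)\<^sup>2 - A"
    unfolding A_def c_def J_eq[symmetric]
    by (rule L2_norm_diff_projection[OF _ orthonormal_subset[OF on] f]) (use fin in \<open>auto simp: J_def\<close>)
  ultimately show ?thesis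
    by (simp only: right_diff_distrib left_diff_distrib mult_zero_left)
qed

end

section \<open>Finiteness of the eigenvalue count and conclusion\<close>

lemma card_le_imp_finite:
  assumes "\<And>J. finite J \<Longrightarrow> J \<subseteq> A \<Longrightarrow> real (card J) \<le> B"
  shows "finite A"
proof (rule ccontr)
  assume "infinite A"
  then obtain J where "finite J" "card J = Suc (nat \<lceil>B\<rceil>)" "J \<subseteq> A"
    using infinite_arbitrarily_large by metis
  with assms[of J] show False by linarith
qed

theorem corollary5p6:
  fixes \<Omega> :: "'a::euclidean_space set"
    and \<mu> :: "'a measure"
    and a c\<^sub>K :: real
    and Q :: "'a \<Rightarrow> real"
    and K :: "'a \<Rightarrow> 'a \<Rightarrow> complex"
    and U :: "('a \<Rightarrow> complex) \<Rightarrow> 'a \<Rightarrow> complex"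
    and S \<Sigma> :: "'a set"
    and I :: "nat set"
    and ev :: "nat \<Rightarrow> real"
    and \<phi> :: "nat \<Rightarrow> 'a \<Rightarrow> complex"
    and \<epsilon> \<epsilon>\<^sub>0 \<epsilon>\<^sub>1 \<epsilon>\<^sub>2 :: real
  assumes "integral_transform \<Omega> \<mu> a Q K c\<^sub>K U"
    and "S \<in> sets \<mu>" "0 < emeasure \<mu> S" "emeasure \<mu> S < \<infinity>"
    and "\<Sigma> \<in> sets \<mu>" "0 < emeasure \<mu> \<Sigma>" "emeasure \<mu> \<Sigma> < \<infinity>"
    and "\<epsilon>\<^sub>0 \<in> {0<..<1}" "\<epsilon> \<in> {0<..<1}" "\<epsilon>\<^sub>1 \<in> {0<..<1}" "\<epsilon>\<^sub>2 \<in> {0<..<1}"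
    and "spectral_system \<mu> (localization_op \<mu> U S \<Sigma>) I ev \<phi>"
  shows "(\<forall>f \<in> L2_concentrated \<mu> U \<epsilon>\<^sub>1 \<epsilon>\<^sub>2 S \<Sigma>.
            L2_norm \<mu> (\<lambda>x. f x - (\<Sum>n = 1..eigenvalue_count I ev \<epsilon>\<^sub>0. L2_inner \<mu> f (\<phi> n) * \<phi> n x))
              \<le> sqrt ((2 * \<epsilon>\<^sub>1 + \<epsilon>\<^sub>2) / \<epsilon>\<^sub>0) * L2_norm \<mu> f)
       \<and> (\<forall>f. localized_wrt \<mu> (localization_op \<mu> U S \<Sigma>) \<epsilon> f \<longrightarrow>
            L2_norm \<mu> (\<lambda>x. f x - (\<Sum>n = 1..eigenvalue_count I ev \<epsilon>\<^sub>0. L2_inner \<mu> f (\<phi> n) * \<phi> n x))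
              \<le> sqrt (2 * \<epsilon> / \<epsilon>\<^sub>0) * L2_norm \<mu> f)"
proof -
  interpret integral_transform \<Omega> \<mu> a Q K c\<^sub>K U by fact
  note S = assms(2) and \<Sigma> = assms(5) and spec = assms(12)
  have space: "space \<mu> = \<Omega>"
    using sets_eq_imp_space_eq[OF sets_measure] by (simp add: space_restrict_space)
  have K_meas: "(\<lambda>x. K x \<xi>) \<in> borel_measurable \<mu>" if "\<xi> \<in> space \<mu>" for \<xi>
  proof -
    have "continuous_on \<Omega> ((\<lambda>(x, \<xi>). K x \<xi>) \<circ> (\<lambda>x. (x, \<xi>)))"
      using that unfolding space
      by (intro continuous_on_compose continuous_intros continuous_on_subset[OF continuous_kernel]) auto
    then have "(\<lambda>x. K x \<xi>) \<in> borel_measurable (restrict_space borel \<Omega>)"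
      by (intro borel_measurable_continuous_on_restrict) (simp add: o_def)
    then show ?thesis
      by (simp add: measurable_cong_sets[OF sets_measure])
  qed
  have on: "orthonormal \<mu> I \<phi>"
    using spec unfolding spectral_system_def orthonormal_def by simp
  have \<epsilon>\<^sub>0: "0 < \<epsilon>\<^sub>0" "\<epsilon>\<^sub>0 < 1" using assms(8) by auto
  \<comment> \<open>Since \<open>card\<close> of an infinite set is 0,
    \<open>eigenvalue_count\<close> counts correctly only once this is known. Each index considered
    contributes at least \<open>1 - \<epsilon>\<^sub>0\<close> to a sum that
    \<open>trace_bound\<close> limits uniformly.\<close>
  have fin: "finite {n \<in> I. ev n \<ge> 1 - \<epsilon>\<^sub>0}"
  proof (rule card_le_imp_finite)
    fix J assume J: "finite J" "J \<subseteq> {n \<in> I. ev n \<ge> 1 - \<epsilon>\<^sub>0}"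
    then have JI: "J \<subseteq> I" by auto
    have "real (card J) * (1 - \<epsilon>\<^sub>0) = (\<Sum>n\<in>J. 1 - \<epsilon>\<^sub>0)"
      by simp
    also have "\<dots> \<le> (\<Sum>n\<in>J. quad_form \<mu> U S \<Sigma> (\<phi> n))"
      using J JI by (intro sum_mono) (auto simp flip: eigenvalue_eq[OF unitary S \<Sigma> spec])
    also have "\<dots> \<le> c\<^sub>K\<^sup>2 * measure \<mu> S * measure \<mu> \<Sigma>"
      by (rule trace_bound[OF unitary S \<Sigma> extension K_meas bounded_kernel assms(4,7) J(1)
            orthonormal_subset[OF on JI]]) (auto simp: space)
    finally show "real (card J) \<le> c\<^sub>K\<^sup>2 * measure \<mu> S * measure \<mu> \<Sigma> / (1 - \<epsilon>\<^sub>0)"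
      using \<epsilon>\<^sub>0 by (simp add: field_simps)
  qed
  \<comment> \<open>Both claims are instances, with \<delta> equal to
    \<open>2 * \<epsilon>\<^sub>1 + \<epsilon>\<^sub>2\<close> and to
    \<open>2 * \<epsilon>\<close>.\<close>
  have bound: "L2_norm \<mu> (\<lambda>x. f x - (\<Sum>n = 1..eigenvalue_count I ev \<epsilon>\<^sub>0. L2_inner \<mu> f (\<phi> n) * \<phi> n x))
      \<le> sqrt (\<delta> / \<epsilon>\<^sub>0) * L2_norm \<mu> f"
    if f: "f \<in> L2 \<mu>" and le: "(L2_norm \<mu> f)\<^sup>2 - quad_form \<mu> U S \<Sigma> f \<le> \<delta> * (L2_norm \<mu> f)\<^sup>2" for f \<delta>
  proof -
    let ?D = "L2_norm \<mu> (\<lambda>x. f x - (\<Sum>n = 1..eigenvalue_count I ev \<epsilon>\<^sub>0. L2_inner \<mu> f (\<phi> n) * \<phi> n x))"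
    have "\<epsilon>\<^sub>0 * ?D\<^sup>2 \<le> \<delta> * (L2_norm \<mu> f)\<^sup>2"
      using spectral_projection[OF unitary S \<Sigma> spec fin \<epsilon>\<^sub>0 f] le by linarith
    then have "?D\<^sup>2 \<le> \<delta> / \<epsilon>\<^sub>0 * (L2_norm \<mu> f)\<^sup>2"
      using \<epsilon>\<^sub>0 by (simp add: field_simps)
    then have "?D \<le> sqrt (\<delta> / \<epsilon>\<^sub>0 * (L2_norm \<mu> f)\<^sup>2)"
      by (rule real_le_rsqrt)
    then show ?thesis
      unfolding real_sqrt_mult by (simp add: L2_norm_nonneg)
  qed
  show ?thesis
  proof (intro conjI ballI allI impI)
    fix f assume f: "f \<in> L2_concentrated \<mu> U \<epsilon>\<^sub>1 \<epsilon>\<^sub>2 S \<Sigma>"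
    show "L2_norm \<mu> (\<lambda>x. f x - (\<Sum>n = 1..eigenvalue_count I ev \<epsilon>\<^sub>0. L2_inner \<mu> f (\<phi> n) * \<phi> n x))
        \<le> sqrt ((2 * \<epsilon>\<^sub>1 + \<epsilon>\<^sub>2) / \<epsilon>\<^sub>0) * L2_norm \<mu> f"
    proof (rule bound)
      show "f \<in> L2 \<mu>" using f by (simp add: L2_concentrated_def)
      show "(L2_norm \<mu> f)\<^sup>2 - quad_form \<mu> U S \<Sigma> f \<le> (2 * \<epsilon>\<^sub>1 + \<epsilon>\<^sub>2) * (L2_norm \<mu> f)\<^sup>2"
        by (rule concentrated_quad_form[OF unitary S \<Sigma> f]) (use assms(11) in auto)
    qed
  next
    fix f assume f: "localized_wrt \<mu> (localization_op \<mu> U S \<Sigma>) \<epsilon> f"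
    \<comment> \<open>The form estimate holds already with \<epsilon>; it is weakened to the stated
      constant.\<close>
    have "\<epsilon> * (L2_norm \<mu> f)\<^sup>2 \<le> 2 * \<epsilon> * (L2_norm \<mu> f)\<^sup>2"
      using assms(9) by simp
    with localized_quad_form[OF unitary S \<Sigma> f]
    have le: "(L2_norm \<mu> f)\<^sup>2 - quad_form \<mu> U S \<Sigma> f \<le> 2 * \<epsilon> * (L2_norm \<mu> f)\<^sup>2"
      by linarith
    from f have "f \<in> L2 \<mu>" by (simp add: localized_wrt_def)
    from bound[OF this le] show "L2_norm \<mu> (\<lambda>x. f x - (\<Sum>n = 1..eigenvalue_count I ev \<epsilon>\<^sub>0. L2_inner \<mu> f (\<phi> n) * \<phi> n x))
        \<le> sqrt (2 * \<epsilon> / \<epsilon>\<^sub>0) * L2_norm \<mu> f"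
      .
  qed
qed

end
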